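(* If $f_1,f_2$ depend only on $x^2$, then the following assertions are equivalent: (1) $(I,\tilde g)$ is a flat Riemannian manifold; (2) $f_1$ and $f_2$ satisfy the equation $$\frac{f_1'}{f_1}\frac{f_2'}{f_2}+\frac{f_1''}{f_1}=2\left(\frac{f_1'}{f_1}\right)^2;$$ (3) $f_1$ is constant, or $f_1'$ is nowhere zero and $f_2=c_0\frac{f_1^2}{f_1'}$, where $c_0\in\mathbb R\setminus\{0\}$.
   Context: Let $I=I_1\times I_2\times I_3\subseteq\mathbb R^3$ with $I_1,I_2,I_3\subseteq\mathbb R$ open intervals and standard coordinates $x^1,x^2,x^3$. Let $f_1,f_2$ be smooth nowhere zero functions on $I$ and endow $I$ with the Riemannian metric $\tilde g=\frac{1}{f_1^2}dx^1\otimes dx^1+\frac{1}{f_2^2}dx^2\otimes dx^2+dx^3\otimes dx^3$. Flat means that the Riemann curvature tensor of $\tilde g$ vanishes identically. A prime denotes the derivative with respect to $x^2$. *)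

theory Defs
  imports "HOL-Analysis.Analysis"
begin

text \<open>Functions and tensors on an open set \<open>S\<close> of \<open>\<real>\<^sup>n\<close> are total functions on \<open>\<real>\<^sup>n\<close>;
  their values outside \<open>S\<close> are irrelevant.\<close>

definition partial_deriv :: "'n::finite \<Rightarrow> (real ^ 'n \<Rightarrow> real) \<Rightarrow> real ^ 'n \<Rightarrow> real" where
  "partial_deriv i f x = deriv (\<lambda>t. f (x + t *\<^sub>R axis i 1)) 0"

primrec Ck_on :: "nat \<Rightarrow> (real ^ 'n::finite) set \<Rightarrow> (real ^ 'n \<Rightarrow> real) \<Rightarrow> bool" where
  "Ck_on 0 S f \<longleftrightarrow> continuous_on S f"
| "Ck_on (Suc k) S f \<longleftrightarrow> f differentiable_on S \<and> (\<forall>i. Ck_on k S (partial_deriv i f))"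

definition smooth_on :: "(real ^ 'n::finite) set \<Rightarrow> (real ^ 'n \<Rightarrow> real) \<Rightarrow> bool" where
  "smooth_on S f \<longleftrightarrow> (\<forall>k. Ck_on k S f)"

text \<open>A metric is given by its matrix of components \<open>g x $ i $ j = g\<^sub>x(\<partial>\<^sub>i, \<partial>\<^sub>j)\<close> in the
  standard coordinates.\<close>

definition riemannian_metric_on :: "(real ^ 'n::finite) set \<Rightarrow> (real ^ 'n \<Rightarrow> real ^ 'n ^ 'n) \<Rightarrow> bool" where
  "riemannian_metric_on S g \<longleftrightarrow>
     open S \<and>
     (\<forall>i j. smooth_on S (\<lambda>x. g x $ i $ j)) \<and>
     (\<forall>x\<in>S. transpose (g x) = g x \<and> (\<forall>v. v \<noteq> 0 \<longrightarrow> 0 < v \<bullet> (g x *v v)))"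

text \<open>\<open>christoffel g l i j\<close> is \<open>\<Gamma>\<^sup>l\<^sub>i\<^sub>j\<close>, i.e. the Levi-Civita connection satisfies
  \<open>\<nabla>\<^bsub>\<partial>\<^sub>i\<^esub> \<partial>\<^sub>j = (\<Sum>l. \<Gamma>\<^sup>l\<^sub>i\<^sub>j \<partial>\<^sub>l)\<close>.\<close>

definition christoffel ::
    "(real ^ 'n::finite \<Rightarrow> real ^ 'n ^ 'n) \<Rightarrow> 'n \<Rightarrow> 'n \<Rightarrow> 'n \<Rightarrow> real ^ 'n \<Rightarrow> real" where
  "christoffel g l i j x =
     (1/2) * (\<Sum>m\<in>UNIV. matrix_inv (g x) $ l $ m *
       (partial_deriv i (\<lambda>y. g y $ j $ m) x
        + partial_deriv j (\<lambda>y. g y $ i $ m) x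
        - partial_deriv m (\<lambda>y. g y $ i $ j) x))"

text \<open>\<open>riemann_coeff g l i j k\<close> is the \<open>\<partial>\<^sub>l\<close>-component of
  \<open>R(\<partial>\<^sub>i, \<partial>\<^sub>j)\<partial>\<^sub>k = \<nabla>\<^bsub>\<partial>\<^sub>i\<^esub> \<nabla>\<^bsub>\<partial>\<^sub>j\<^esub> \<partial>\<^sub>k - \<nabla>\<^bsub>\<partial>\<^sub>j\<^esub> \<nabla>\<^bsub>\<partial>\<^sub>i\<^esub> \<partial>\<^sub>k\<close>.\<close>

definition riemann_coeff ::
    "(real ^ 'n::finite \<Rightarrow> real ^ 'n ^ 'n) \<Rightarrow> 'n \<Rightarrow> 'n \<Rightarrow> 'n \<Rightarrow> 'n \<Rightarrow> real ^ 'n \<Rightarrow> real" where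
  "riemann_coeff g l i j k x =
     partial_deriv i (christoffel g l j k) x - partial_deriv j (christoffel g l i k) x
     + (\<Sum>m\<in>UNIV. christoffel g l i m x * christoffel g m j k x
                - christoffel g l j m x * christoffel g m i k x)"

text \<open>The value \<open>R(u, v)w\<close> of the curvature tensor at \<open>x\<close> on tangent vectors \<open>u\<close>, \<open>v\<close>, \<open>w\<close>.\<close>

definition riemann_curvature ::
    "(real ^ 'n::finite \<Rightarrow> real ^ 'n ^ 'n) \<Rightarrow> real ^ 'n \<Rightarrow> real ^ 'n \<Rightarrow> real ^ 'n \<Rightarrow> real ^ 'n \<Rightarrow> real ^ 'n" where
  "riemann_curvature g x u v w =
     (\<chi> l. \<Sum>i\<in>UNIV. \<Sum>j\<in>UNIV. \<Sum>k\<in>UNIV. riemann_coeff g l i j k x * u $ i * v $ j * w $ k)"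

definition flat_riemannian_manifold :: "(real ^ 'n::finite) set \<Rightarrow> (real ^ 'n \<Rightarrow> real ^ 'n ^ 'n) \<Rightarrow> bool" where
  "flat_riemannian_manifold S g \<longleftrightarrow>
     riemannian_metric_on S g \<and> (\<forall>x\<in>S. \<forall>u v w. riemann_curvature g x u v w = 0)"

definition box3 :: "real set \<Rightarrow> real set \<Rightarrow> real set \<Rightarrow> (real ^ 3) set" where
  "box3 I1 I2 I3 = {x. x $ 1 \<in> I1 \<and> x $ 2 \<in> I2 \<and> x $ 3 \<in> I3}"

definition metric_tilde :: "(real ^ 3 \<Rightarrow> real) \<Rightarrow> (real ^ 3 \<Rightarrow> real) \<Rightarrow> real ^ 3 \<Rightarrow> real ^ 3 ^ 3" where
  "metric_tilde f1 f2 x =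
     vector [vector [1 / (f1 x)\<^sup>2, 0, 0],
             vector [0, 1 / (f2 x)\<^sup>2, 0],
             vector [0, 0, 1]]"

definition depends_only_on_x2 :: "(real ^ 3) set \<Rightarrow> (real ^ 3 \<Rightarrow> real) \<Rightarrow> bool" where
  "depends_only_on_x2 S f \<longleftrightarrow> (\<forall>x\<in>S. \<forall>y\<in>S. x $ 2 = y $ 2 \<longrightarrow> f x = f y)"

abbreviation deriv_x2 :: "(real ^ 3 \<Rightarrow> real) \<Rightarrow> real ^ 3 \<Rightarrow> real" where
  "deriv_x2 f \<equiv> partial_deriv 2 f"

end

theory Submission
  imports Defs
begin

text \<open>Set \<open>K = (f\<^sub>1'/f\<^sub>1)(f\<^sub>2'/f\<^sub>2) + f\<^sub>1''/f\<^sub>1 - 2 (f\<^sub>1'/f\<^sub>1)\<^sup>2\<close>. Up to the antisymmetry in the first two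
  arguments, the only components of the curvature tensor that can be nonzero are
  \<open>R\<^sup>1\<^sub>1\<^sub>2\<^sub>2 = K\<close> and \<open>R\<^sup>2\<^sub>1\<^sub>2\<^sub>1 = -(f\<^sub>2/f\<^sub>1)\<^sup>2 K\<close>, so flatness means \<open>K = 0\<close>. On the other hand
  \<open>(f\<^sub>1' f\<^sub>2 / f\<^sub>1\<^sup>2)' = (f\<^sub>2/f\<^sub>1) K\<close>, so \<open>K = 0\<close> means that \<open>f\<^sub>1' f\<^sub>2 / f\<^sub>1\<^sup>2\<close> is a constant \<open>c\<^sub>0\<close>;
  the value \<open>c\<^sub>0 = 0\<close> gives constant \<open>f\<^sub>1\<close> and a nonzero one the formula for \<open>f\<^sub>2\<close>.\<close>

section \<open>Partial derivatives and functions of class \<open>C\<^sup>k\<close>\<close>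

lemma eventually_line_in_open:
  fixes x v :: "'a::real_normed_vector"
  assumes "open S" "x \<in> S"
  shows "\<forall>\<^sub>F t in nhds (0::real). x + t *\<^sub>R v \<in> S"
proof -
  have "open ((\<lambda>t. x + t *\<^sub>R v) -` S)"
    by (intro open_vimage assms continuous_intros)
  then show ?thesis
    unfolding eventually_nhds using assms by (intro exI[of _ "(\<lambda>t. x + t *\<^sub>R v) -` S"]) auto
qed

text \<open>A partial derivative sees only values on a short segment through \<open>x\<close>, which
  stays in the open set \<open>S\<close>. Hence formulas valid on \<open>S\<close> alone may be
  differentiated there.\<close>

lemma partial_deriv_cong:
  assumes "open S" "x \<in> S" "\<And>y. y \<in> S \<Longrightarrow> f y = g y"
  shows "partial_deriv i f x = partial_deriv i g x"
  unfolding partial_deriv_def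
  using eventually_line_in_open[OF assms(1,2), of "axis i 1"]
  by (intro deriv_cong_ev) (auto elim!: eventually_mono simp: assms)

lemma partial_deriv_const [simp]: "partial_deriv i (\<lambda>_. c) x = 0"
  by (simp add: partial_deriv_def)

lemma has_derivative_partial:
  assumes "(f has_derivative f') (at x)"
  shows "((\<lambda>t. f (x + t *\<^sub>R axis i 1)) has_real_derivative f' (axis i 1)) (at 0)"
proof -
  \<comment> \<open>The base point is written as the value of the line at parameter 0, the shape
    that the chain rule expects.\<close>
  have "(f has_derivative f') (at (x + 0 *\<^sub>R axis i 1))"
    using assms by simp
  then have "((\<lambda>t. f (x + t *\<^sub>R axis i 1)) has_derivative (\<lambda>t. f' (t *\<^sub>R axis i 1))) (at 0)"
    by (rule has_derivative_compose[rotated]) (auto intro!: derivative_eq_intros)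
  moreover have "(\<lambda>t. f' (t *\<^sub>R axis i 1)) = (*) (f' (axis i 1))"
    using has_derivative_linear[OF assms] by (auto simp: linear_cmul)
  ultimately show ?thesis
    by (simp add: has_field_derivative_def)
qed

lemma partial_deriv_eqI:
  "((\<lambda>t. f (x + t *\<^sub>R axis i 1)) has_real_derivative D) (at 0) \<Longrightarrow> partial_deriv i f x = D"
  unfolding partial_deriv_def by (rule DERIV_imp_deriv)

lemma partial_deriv_inverse_square:
  assumes "((\<lambda>t. f (x + t *\<^sub>R axis i 1)) has_real_derivative D) (at 0)" "f x \<noteq> 0"
  shows "partial_deriv i (\<lambda>y. 1 / (f y)\<^sup>2) x = - 2 * D / (f x) ^ 3"
  by (rule partial_deriv_eqI,
      (rule derivative_eq_intros assms(1) refl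
        | simp add: assms(2) field_simps power_numeral_reduce)+)

text \<open>\<open>deriv\<close> is a choice operator; differentiability makes its value a genuine
  derivative along the line, so that the usual differentiation rules apply.\<close>

lemma differentiable_partial:
  assumes "open S" "f differentiable_on S" "x \<in> S"
  shows "((\<lambda>t. f (x + t *\<^sub>R axis i 1)) has_real_derivative partial_deriv i f x) (at 0)"
proof -
  obtain f' where "(f has_derivative f') (at x)"
    using assms by (auto simp: differentiable_on_eq_differentiable_at differentiable_def)
  note D = has_derivative_partial[OF this, of i]
  with partial_deriv_eqI[OF D] show ?thesis
    by simp
qed

text \<open>The total derivative is linear and vanishes on the standard basis, so it is zero;
  convexity then gives constancy.\<close>

lemma constant_on_if_partial_deriv_zero:
  fixes f :: "real ^ 'n::finite \<Rightarrow> real"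
  assumes "open S" "convex S" "f differentiable_on S"
    and "\<And>i x. x \<in> S \<Longrightarrow> partial_deriv i f x = 0"
  shows "f constant_on S"
proof -
  have "(f has_derivative (\<lambda>_. 0)) (at x within S)" if x: "x \<in> S" for x
  proof -
    obtain f' where f': "(f has_derivative f') (at x)"
      using assms(1,3) x by (auto simp: differentiable_on_eq_differentiable_at differentiable_def)
    have "f' (axis i 1) = 0" for i
      using partial_deriv_eqI[OF has_derivative_partial[OF f']] assms(4)[OF x] by metis
    then have "f' = (\<lambda>_. 0)"
      by (intro linear_eq_stdbasis[OF has_derivative_linear[OF f'] linear_zero])
        (auto simp: Basis_vec_def)
    with f' show ?thesis
      by (simp add: has_derivative_at_withinI)
  qed
  from has_derivative_zero_constant[OF assms(2) this] show ?thesis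
    by (auto simp: constant_on_def)
qed

text \<open>The sum, product and reciprocal rules hold only at points of \<open>S\<close>. This lets
  the inductions below replace a partial derivative by its formula.\<close>

lemma Ck_on_cong:
  assumes "open S" "\<And>x. x \<in> S \<Longrightarrow> f x = g x"
  shows "Ck_on k S f = Ck_on k S g"
  using assms(2)
proof (induction k arbitrary: f g)
  case 0
  then show ?case by (simp cong: continuous_on_cong)
next
  case (Suc k)
  have "f differentiable_on S \<longleftrightarrow> g differentiable_on S"
    using Suc.prems by (auto simp: differentiable_on_def intro: differentiable_transform_within[OF _ zero_less_one])
  moreover have "Ck_on k S (partial_deriv i f) = Ck_on k S (partial_deriv i g)" for i
    using partial_deriv_cong[OF assms(1)] Suc.prems by (intro Suc.IH) blast
  ultimately show ?case by simp
qed

lemma Ck_on_SucD: "Ck_on (Suc k) S f \<Longrightarrow> Ck_on k S f"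
  by (induction k arbitrary: f) (auto intro: differentiable_imp_continuous_on)

lemma Ck_on_const: "Ck_on k S (\<lambda>_. c)"
proof (induction k arbitrary: c)
  case (Suc k)
  have "partial_deriv i (\<lambda>_. c) = (\<lambda>_. 0)" for i :: 'a
    by auto
  with Suc show ?case by auto
qed auto

lemma Ck_on_add:
  assumes "open S" "Ck_on k S f" "Ck_on k S g"
  shows "Ck_on k S (\<lambda>x. f x + g x)"
  using assms(2,3)
proof (induction k arbitrary: f g)
  case (Suc k)
  have "partial_deriv i (\<lambda>x. f x + g x) x = partial_deriv i f x + partial_deriv i g x"
    if "x \<in> S" for i x
    using differentiable_partial[OF assms(1) _ that] Suc.prems
    by (intro partial_deriv_eqI) (auto intro!: derivative_intros)
  then have "Ck_on k S (partial_deriv i (\<lambda>x. f x + g x))" for i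
    using Suc by (subst Ck_on_cong[OF assms(1)]) auto
  with Suc.prems show ?case by auto
qed (auto intro: continuous_on_add)

text \<open>Induction on \<open>k\<close> by the product rule. Its terms contain undifferentiated
  factors, which \<open>Ck_on_SucD\<close> lowers to the level of the induction hypothesis.\<close>

lemma Ck_on_mult:
  assumes "open S" "Ck_on k S f" "Ck_on k S g"
  shows "Ck_on k S (\<lambda>x. f x * g x)"
  using assms(2,3)
proof (induction k arbitrary: f g)
  case (Suc k)
  have "partial_deriv i (\<lambda>x. f x * g x) x = partial_deriv i f x * g x + f x * partial_deriv i g x"
    if "x \<in> S" for i x
    using differentiable_partial[OF assms(1) _ that] Suc.prems
    by (intro partial_deriv_eqI) (auto intro!: derivative_eq_intros)
  moreover have "Ck_on k S (\<lambda>x. partial_deriv i f x * g x + f x * partial_deriv i g x)" for i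
    using Suc.prems Suc.prems[THEN Ck_on_SucD] by (intro Ck_on_add Suc.IH assms(1)) auto
  ultimately have "Ck_on k S (partial_deriv i (\<lambda>x. f x * g x))" for i
    by (subst Ck_on_cong[OF assms(1)]) auto
  with Suc.prems show ?case by auto
qed (auto intro: continuous_on_mult)

text \<open>The derivative of the reciprocal is a product of a constant, a partial derivative of
  \<open>f\<close> and two copies of the reciprocal itself, so the induction closes with
  \<open>f\<close> fixed.\<close>

lemma Ck_on_inverse:
  assumes "open S" "Ck_on k S f" and nz: "\<And>x. x \<in> S \<Longrightarrow> f x \<noteq> 0"
  shows "Ck_on k S (\<lambda>x. inverse (f x))"
  using assms(2)
proof (induction k)
  case 0
  with nz show ?case by (auto intro: continuous_on_inverse)
next
  case (Suc k)
  have "partial_deriv i (\<lambda>x. inverse (f x)) x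
      = (- 1) * partial_deriv i f x * (inverse (f x) * inverse (f x))"
    if "x \<in> S" for i x
    using differentiable_partial[OF assms(1) _ that] Suc.prems nz[OF that]
    by (intro partial_deriv_eqI) (auto intro!: derivative_eq_intros simp: power2_eq_square)
  moreover have "Ck_on k S (\<lambda>x. (- 1) * partial_deriv i f x * (inverse (f x) * inverse (f x)))" for i
    using Suc.prems Suc.prems[THEN Ck_on_SucD]
    by (intro Ck_on_mult Ck_on_const Suc.IH assms(1)) auto
  ultimately have "Ck_on k S (partial_deriv i (\<lambda>x. inverse (f x)))" for i
    by (subst Ck_on_cong[OF assms(1)]) auto
  moreover have "(\<lambda>x. inverse (f x)) differentiable_on S"
    using Suc.prems nz by (auto simp: differentiable_on_def intro!: differentiable_inverse)
  ultimately show ?case by simp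
qed

lemma smooth_on_const: "smooth_on S (\<lambda>_. c)"
  by (simp add: smooth_on_def Ck_on_const)

lemma smooth_on_inverse_square:
  assumes "open S" "smooth_on S f" "\<And>x. x \<in> S \<Longrightarrow> f x \<noteq> 0"
  shows "smooth_on S (\<lambda>x. 1 / (f x)\<^sup>2)"
proof -
  have "(\<lambda>x. 1 / (f x)\<^sup>2) = (\<lambda>x. inverse (f x) * inverse (f x))"
    by (auto simp: power2_eq_square divide_simps)
  with assms show ?thesis
    by (auto simp: smooth_on_def intro!: Ck_on_mult Ck_on_inverse)
qed

lemma smooth_on_partial_deriv: "smooth_on S f \<Longrightarrow> smooth_on S (partial_deriv i f)"
  unfolding smooth_on_def by (metis Ck_on.simps(2))

lemma smooth_on_imp_differentiable_on: "smooth_on S f \<Longrightarrow> f differentiable_on S"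
  unfolding smooth_on_def by (metis Ck_on.simps(2))

section \<open>The metric\<close>

lemma depends_only_on_x2D:
  "depends_only_on_x2 S f \<Longrightarrow> x \<in> S \<Longrightarrow> y \<in> S \<Longrightarrow> x $ 2 = y $ 2 \<Longrightarrow> f x = f y"
  unfolding depends_only_on_x2_def by blast

text \<open>Moving along an axis other than the second keeps the second coordinate, so
  \<open>f\<close> is constant on a short segment.\<close>

lemma partial_deriv_depends_only:
  assumes "open S" "depends_only_on_x2 S f" "x \<in> S" "i \<noteq> 2"
  shows "partial_deriv i f x = 0"
proof -
  have "\<forall>\<^sub>F t in nhds 0. f (x + t *\<^sub>R axis i 1) = f x"
    using eventually_line_in_open[OF assms(1,3), of "axis i 1"]
  proof eventually_elim
    case (elim t)
    then show ?case
      by (rule depends_only_on_x2D[OF assms(2) _ assms(3)]) (use assms(4) in \<open>simp add: axis_def\<close>)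
  qed
  then have "partial_deriv i f x = deriv (\<lambda>_. f x) 0"
    unfolding partial_deriv_def by (rule deriv_cong_ev) simp
  then show ?thesis by simp
qed

text \<open>Parallel lines through \<open>x\<close> and \<open>y\<close> have equal second
  coordinates at equal parameters, so the two difference quotients agree for small
  parameters.\<close>

lemma depends_only_partial_deriv:
  assumes "open S" "depends_only_on_x2 S f"
  shows "depends_only_on_x2 S (partial_deriv i f)"
  unfolding depends_only_on_x2_def
proof (intro ballI impI)
  fix x y assume xy: "x \<in> S" "y \<in> S" "x $ 2 = y $ 2"
  have "\<forall>\<^sub>F t in nhds 0. f (x + t *\<^sub>R axis i 1) = f (y + t *\<^sub>R axis i 1)"
    using eventually_line_in_open[OF assms(1) xy(1), of "axis i 1"]
      eventually_line_in_open[OF assms(1) xy(2), of "axis i 1"]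
    by eventually_elim (rule depends_only_on_x2D[OF assms(2)], simp_all add: xy(3))
  then show "partial_deriv i f x = partial_deriv i f y"
    unfolding partial_deriv_def by (rule deriv_cong_ev) simp
qed

lemma box3_eq: "box3 I1 I2 I3 = (\<lambda>x. x $ 1) -` I1 \<inter> (\<lambda>x. x $ 2) -` I2 \<inter> (\<lambda>x. x $ 3) -` I3"
  by (auto simp: box3_def)

lemma open_box3: "open I1 \<Longrightarrow> open I2 \<Longrightarrow> open I3 \<Longrightarrow> open (box3 I1 I2 I3)"
  unfolding box3_eq by (intro open_Int open_vimage_vec_nth)

lemma convex_box3:
  assumes "is_interval I1" "is_interval I2" "is_interval I3"
  shows "convex (box3 I1 I2 I3)"
proof -
  have "linear (\<lambda>x :: real ^ 3. x $ i)" for i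
    by (rule linearI) auto
  with assms show ?thesis
    unfolding box3_eq is_interval_convex_1
    by (intro convex_Int convex_linear_vimage)
qed

lemma metric_tilde_nth:
  "metric_tilde f1 f2 x $ i $ j =
    (if i = j then if i = 1 then 1 / (f1 x)\<^sup>2 else if i = 2 then 1 / (f2 x)\<^sup>2 else 1 else 0)"
  using exhaust_3[of i] exhaust_3[of j] by (auto simp: metric_tilde_def vector_3)

lemma matrix_inv_metric_tilde:
  assumes "f1 x \<noteq> 0" "f2 x \<noteq> 0"
  shows "matrix_inv (metric_tilde f1 f2 x) $ i $ j =
    (if i = j then if i = 1 then (f1 x)\<^sup>2 else if i = 2 then (f2 x)\<^sup>2 else 1 else 0)"
proof -
  let ?B = "\<chi> i j. if i = j then if i = (1::3) then (f1 x)\<^sup>2 else if i = 2 then (f2 x)\<^sup>2 else 1 else 0"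
  have "metric_tilde f1 f2 x ** ?B = mat 1" "?B ** metric_tilde f1 f2 x = mat 1"
    using assms by (auto simp: vec_eq_iff forall_3 matrix_matrix_mult_def sum_3 metric_tilde_nth mat_def)
  note inv = this
  then have "\<exists>B. metric_tilde f1 f2 x ** B = mat 1 \<and> B ** metric_tilde f1 f2 x = mat 1"
    by blast
  \<comment> \<open>\<open>matrix_inv\<close> is a choice among two-sided inverses. As one exists,
    the chosen matrix is a left inverse, and associativity identifies it with
    \<open>?B\<close>.\<close>
  from someI_ex[OF this] have "matrix_inv (metric_tilde f1 f2 x) ** metric_tilde f1 f2 x = mat 1"
    unfolding matrix_inv_def by blast
  then have "matrix_inv (metric_tilde f1 f2 x) = ?B"
    using inv(1) matrix_mul_assoc[of "matrix_inv (metric_tilde f1 f2 x)" "metric_tilde f1 f2 x" ?B]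
    by simp
  then show ?thesis by simp
qed

text \<open>The curvature computation is local and takes place on an open set; convexity enters
  later, in the lemmas that deduce constancy.\<close>

locale x2_metric =
  fixes S :: "(real ^ 3) set" and f1 f2 :: "real ^ 3 \<Rightarrow> real"
  assumes open_S: "open S"
    and smooth1: "smooth_on S f1" and smooth2: "smooth_on S f2"
    and nz1: "x \<in> S \<Longrightarrow> f1 x \<noteq> 0" and nz2: "x \<in> S \<Longrightarrow> f2 x \<noteq> 0"
    and only1: "depends_only_on_x2 S f1" and only2: "depends_only_on_x2 S f2"
begin

abbreviation "A \<equiv> partial_deriv 2 f1"
abbreviation "A' \<equiv> partial_deriv 2 A"
abbreviation "B \<equiv> partial_deriv 2 f2"

text \<open>Geometrically, \<open>(f2 x)\<^sup>2 * K x\<close> is the Gaussian curvature of the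
  surface on which the third coordinate is fixed.\<close>

definition K :: "real ^ 3 \<Rightarrow> real" where
  "K x = A x / f1 x * (B x / f2 x) + A' x / f1 x - 2 * (A x / f1 x)\<^sup>2"

lemma only_A: "depends_only_on_x2 S A" and only_B: "depends_only_on_x2 S B"
  using depends_only_partial_deriv open_S only1 only2 by auto

lemma line_derivs:
  assumes "x \<in> S"
  shows "((\<lambda>t. f1 (x + t *\<^sub>R axis 2 1)) has_real_derivative A x) (at 0)"
    and "((\<lambda>t. f2 (x + t *\<^sub>R axis 2 1)) has_real_derivative B x) (at 0)"
    and "((\<lambda>t. A (x + t *\<^sub>R axis 2 1)) has_real_derivative A' x) (at 0)"
  by (intro differentiable_partial[OF open_S _ assms] smooth_on_imp_differentiable_on
      smooth_on_partial_deriv smooth1 smooth2)+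

lemma riemannian_metric: "riemannian_metric_on S (metric_tilde f1 f2)"
  unfolding riemannian_metric_on_def
proof (intro conjI allI ballI impI open_S)
  fix i j :: 3
  consider "i = j" "i = 1" | "i = j" "i = 2" | "i = j" "i \<noteq> 1" "i \<noteq> 2" | "i \<noteq> j"
    by blast
  then show "smooth_on S (\<lambda>x. metric_tilde f1 f2 x $ i $ j)"
    using smooth_on_inverse_square[OF open_S smooth1 nz1]
      smooth_on_inverse_square[OF open_S smooth2 nz2]
    by cases (simp_all add: metric_tilde_nth smooth_on_const)
next
  fix x
  show "transpose (metric_tilde f1 f2 x) = metric_tilde f1 f2 x"
    by (simp add: transpose_def vec_eq_iff metric_tilde_nth)
next
  fix x and v :: "real ^ 3" assume "x \<in> S" "v \<noteq> 0"
  have "v \<bullet> (metric_tilde f1 f2 x *v v) = (v $ 1 / f1 x)\<^sup>2 + (v $ 2 / f2 x)\<^sup>2 + (v $ 3)\<^sup>2"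
    by (simp add: inner_vec_def sum_3 matrix_vector_mult_def metric_tilde_nth power2_eq_square)
  moreover have "v $ 1 / f1 x \<noteq> 0 \<or> v $ 2 / f2 x \<noteq> 0 \<or> v $ 3 \<noteq> 0"
    using \<open>v \<noteq> 0\<close> nz1[OF \<open>x \<in> S\<close>] nz2[OF \<open>x \<in> S\<close>] by (auto simp: vec_eq_iff forall_3)
  ultimately show "0 < v \<bullet> (metric_tilde f1 f2 x *v v)"
    by (smt (verit) zero_less_power2 zero_le_power2)
qed

section \<open>Christoffel symbols of the metric\<close>

lemma partial_deriv_metric:
  assumes "x \<in> S"
  shows "partial_deriv i (\<lambda>y. metric_tilde f1 f2 y $ j $ k) x =
    (if i = 2 \<and> j = k then
       if j = 1 then - 2 * A x / (f1 x) ^ 3 else if j = 2 then - 2 * B x / (f2 x) ^ 3 else 0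
     else 0)"
proof (cases "i = 2")
  case True
  have "partial_deriv 2 (\<lambda>y. 1 / (f1 y)\<^sup>2) x = - 2 * A x / (f1 x) ^ 3"
    "partial_deriv 2 (\<lambda>y. 1 / (f2 y)\<^sup>2) x = - 2 * B x / (f2 x) ^ 3"
    using partial_deriv_inverse_square line_derivs[OF assms] nz1[OF assms] nz2[OF assms] by blast+
  with True show ?thesis
    by (auto simp: metric_tilde_nth)
next
  case False
  have "depends_only_on_x2 S (\<lambda>y. metric_tilde f1 f2 y $ j $ k)"
    unfolding depends_only_on_x2_def
  proof (intro ballI impI)
    fix y z assume yz: "y \<in> S" "z \<in> S" "y $ 2 = z $ 2"
    show "metric_tilde f1 f2 y $ j $ k = metric_tilde f1 f2 z $ j $ k"
      by (simp only: metric_tilde_nth depends_only_on_x2D[OF only1 yz] depends_only_on_x2D[OF only2 yz])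
  qed
  with False show ?thesis
    using partial_deriv_depends_only[OF open_S _ assms] by simp
qed

text \<open>The Christoffel symbols in closed form, without matrix inverses or derivatives of metric
  entries, ready to be differentiated once more.\<close>

definition gam :: "3 \<Rightarrow> 3 \<Rightarrow> 3 \<Rightarrow> real ^ 3 \<Rightarrow> real" where
  "gam l i j x =
    (if l = 1 \<and> (i = 1 \<and> j = 2 \<or> i = 2 \<and> j = 1) then - (A x / f1 x)
     else if l = 2 \<and> i = 1 \<and> j = 1 then (f2 x)\<^sup>2 * A x / (f1 x) ^ 3
     else if l = 2 \<and> i = 2 \<and> j = 2 then - (B x / f2 x)
     else 0)"

lemma christoffel_eq_gam:
  assumes "x \<in> S"
  shows "christoffel (metric_tilde f1 f2) l i j x = gam l i j x"
  unfolding christoffel_def partial_deriv_metric[OF assms] sum_3 gam_def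
    matrix_inv_metric_tilde[of f1 x f2, OF nz1[OF assms] nz2[OF assms]]
  using exhaust_3[of l] exhaust_3[of i] exhaust_3[of j] nz1[OF assms] nz2[OF assms]
  by (elim disjE; simp add: field_simps power_numeral_reduce)

text \<open>The derivative of \<open>\<Gamma>\<^sup>2\<^sub>2\<^sub>2\<close> stays unevaluated: it
  enters the curvature only when all indices are 2, where it cancels against itself. So no second
  derivative of \<open>f2\<close> has to be computed.\<close>

lemma partial_deriv_gam:
  assumes "x \<in> S"
  shows "partial_deriv m (gam l i j) x =
    (if m \<noteq> 2 then 0
     else if l = 1 \<and> (i = 1 \<and> j = 2 \<or> i = 2 \<and> j = 1) then (A x / f1 x)\<^sup>2 - A' x / f1 x
     else if l = 2 \<and> i = 1 \<and> j = 1 then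
       (f2 x / f1 x)\<^sup>2 * (2 * (B x / f2 x) * (A x / f1 x) + A' x / f1 x - 3 * (A x / f1 x)\<^sup>2)
     else if l = 2 \<and> i = 2 \<and> j = 2 then partial_deriv 2 (\<lambda>y. - (B y / f2 y)) x
     else 0)"
proof (cases "m = 2")
  case True
  have "partial_deriv 2 (\<lambda>y. - (A y / f1 y)) x = (A x / f1 x)\<^sup>2 - A' x / f1 x"
    by (rule partial_deriv_eqI,
      (rule derivative_eq_intros line_derivs[OF assms] refl
        | simp add: nz1[OF assms] nz2[OF assms] field_simps power_numeral_reduce)+)
  moreover have "partial_deriv 2 (\<lambda>y. (f2 y)\<^sup>2 * A y / (f1 y) ^ 3) x =
      (f2 x / f1 x)\<^sup>2 * (2 * (B x / f2 x) * (A x / f1 x) + A' x / f1 x - 3 * (A x / f1 x)\<^sup>2)"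
    by (rule partial_deriv_eqI,
      (rule derivative_eq_intros line_derivs[OF assms] refl
        | simp add: nz1[OF assms] nz2[OF assms] field_simps power_numeral_reduce)+)
  ultimately show ?thesis
    using True by (auto simp: gam_def[abs_def])
next
  case False
  have "depends_only_on_x2 S (gam l i j)"
    unfolding depends_only_on_x2_def
  proof (intro ballI impI)
    fix y z assume yz: "y \<in> S" "z \<in> S" "y $ 2 = z $ 2"
    show "gam l i j y = gam l i j z"
      by (simp only: gam_def depends_only_on_x2D[OF only1 yz] depends_only_on_x2D[OF only2 yz]
          depends_only_on_x2D[OF only_A yz] depends_only_on_x2D[OF only_B yz])
  qed
  with False show ?thesis
    using partial_deriv_depends_only[OF open_S _ assms] by simp
qed

section \<open>Curvature tensor and flatness\<close>

lemma riemann_coeff_eq: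
  assumes "x \<in> S"
  shows "riemann_coeff (metric_tilde f1 f2) l i j k x =
    (if l = 1 \<and> k = 2 \<and> i = 1 \<and> j = 2 then K x
     else if l = 1 \<and> k = 2 \<and> i = 2 \<and> j = 1 then - K x
     else if l = 2 \<and> k = 1 \<and> i = 1 \<and> j = 2 then - ((f2 x / f1 x)\<^sup>2 * K x)
     else if l = 2 \<and> k = 1 \<and> i = 2 \<and> j = 1 then (f2 x / f1 x)\<^sup>2 * K x
     else 0)"
proof -
  \<comment> \<open>The closed form is known on \<open>S\<close> only; openness of \<open>S\<close>
    allows it to be differentiated in place of the Christoffel symbol.\<close>
  have pd: "partial_deriv m (christoffel (metric_tilde f1 f2) l i j) x = partial_deriv m (gam l i j) x"
    for m l i j
    by (rule partial_deriv_cong[OF open_S assms christoffel_eq_gam])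
  show ?thesis
    unfolding riemann_coeff_def pd christoffel_eq_gam[OF assms] partial_deriv_gam[OF assms] sum_3 K_def gam_def
    using exhaust_3[of l] exhaust_3[of i] exhaust_3[of j] exhaust_3[of k] nz1[OF assms] nz2[OF assms]
    by (elim disjE; simp add: field_simps power_numeral_reduce)
qed

lemma flat_iff: "flat_riemannian_manifold S (metric_tilde f1 f2) \<longleftrightarrow> (\<forall>x\<in>S. K x = 0)"
proof
  assume flat: "flat_riemannian_manifold S (metric_tilde f1 f2)"
  show "\<forall>x\<in>S. K x = 0"
  proof
    fix x assume "x \<in> S"
    \<comment> \<open>These three basis vectors and the first component isolate the coefficient with
      value \<open>K x\<close>; conversely, every coefficient is a multiple of
      \<open>K x\<close>.\<close>
    have "0 = riemann_curvature (metric_tilde f1 f2) x (axis 1 1) (axis 2 1) (axis 2 1) $ 1"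
      using flat \<open>x \<in> S\<close> by (simp add: flat_riemannian_manifold_def)
    also have "\<dots> = K x"
      by (simp add: riemann_curvature_def sum_3 riemann_coeff_eq[OF \<open>x \<in> S\<close>] axis_def)
    finally show "K x = 0" by simp
  qed
next
  assume "\<forall>x\<in>S. K x = 0"
  then show "flat_riemannian_manifold S (metric_tilde f1 f2)"
    by (auto simp: flat_riemannian_manifold_def riemannian_metric riemann_curvature_def
        riemann_coeff_eq vec_eq_iff intro!: sum.neutral)
qed

section \<open>The first integral of the flatness equation\<close>

definition W :: "real ^ 3 \<Rightarrow> real" where
  "W x = A x * f2 x / (f1 x)\<^sup>2"

text \<open>With respect to the unit field \<open>f2\<close> times the second coordinate field,
  \<open>W\<close> is minus the derivative of \<open>1 / f1\<close>; differentiating it once more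
  produces the curvature.\<close>

lemma partial_deriv_W:
  assumes "x \<in> S"
  shows "partial_deriv 2 W x = f2 x / f1 x * K x"
  unfolding W_def K_def
  by (rule partial_deriv_eqI,
      (rule derivative_eq_intros line_derivs[OF assms] refl
        | simp add: nz1[OF assms] nz2[OF assms] field_simps power_numeral_reduce)+)

text \<open>The factor \<open>f2 / f1\<close> has no zero, so \<open>K\<close> vanishes exactly when
  the second partial derivative of \<open>W\<close> does. The other partial derivatives vanish
  because \<open>W\<close> depends only on the second coordinate.\<close>

lemma K_zero_iff_W_constant:
  assumes "convex S"
  shows "(\<forall>x\<in>S. K x = 0) \<longleftrightarrow> W constant_on S"
proof
  assume K: "\<forall>x\<in>S. K x = 0"
  have "depends_only_on_x2 S W"
    using only1 only2 only_A unfolding depends_only_on_x2_def W_def by metis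
  then have "partial_deriv i W x = 0" if "x \<in> S" for i x
    using partial_deriv_depends_only[OF open_S _ that] partial_deriv_W[OF that] K that
    by (cases "i = 2") auto
  moreover have "W differentiable_on S"
    unfolding W_def
    using smooth1 smooth2 smooth_on_partial_deriv[OF smooth1, of 2] nz1
    by (auto intro!: derivative_intros dest!: smooth_on_imp_differentiable_on
        simp: differentiable_on_def)
  ultimately show "W constant_on S"
    by (intro constant_on_if_partial_deriv_zero open_S assms)
next
  assume "W constant_on S"
  then obtain c where c: "W x = c" if "x \<in> S" for x
    by (auto simp: constant_on_def)
  show "\<forall>x\<in>S. K x = 0"
  proof
    fix x assume x: "x \<in> S"
    have "partial_deriv 2 W x = 0"
      using partial_deriv_cong[OF open_S x c] by simp
    with x show "K x = 0"
      using partial_deriv_W nz1 nz2 by auto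
  qed
qed

lemma W_constant_iff:
  assumes "convex S"
  shows "W constant_on S \<longleftrightarrow>
    f1 constant_on S \<or>
    (\<forall>x\<in>S. A x \<noteq> 0) \<and> (\<exists>c0. c0 \<noteq> 0 \<and> (\<forall>x\<in>S. f2 x = c0 * ((f1 x)\<^sup>2 / A x)))"
    (is "_ \<longleftrightarrow> ?R")
proof
  assume "W constant_on S"
  then obtain c where c: "W x = c" if "x \<in> S" for x
    by (auto simp: constant_on_def)
  show ?R
  \<comment> \<open>A single \<open>c\<close> serves all of \<open>S\<close> and \<open>f2\<close>
    has no zero, so \<open>A\<close> vanishes everywhere or nowhere. In the latter case, solving
    \<open>W x = c\<close> for \<open>f2 x\<close> gives \<open>c\<close> as the witness for
    \<open>c0\<close>.\<close>
  proof (cases "c = 0")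
    case True
    have "partial_deriv i f1 x = 0" if "x \<in> S" for i x
      using c[OF that] True nz1[OF that] nz2[OF that] partial_deriv_depends_only[OF open_S only1 that]
      by (cases "i = 2") (auto simp: W_def)
    then have "f1 constant_on S"
      by (intro constant_on_if_partial_deriv_zero open_S assms
          smooth_on_imp_differentiable_on smooth1)
    then show ?thesis ..
  next
    case False
    have "A x \<noteq> 0" if "x \<in> S" for x
      using c[OF that] False by (auto simp: W_def)
    moreover have "f2 x = c * ((f1 x)\<^sup>2 / A x)" if "x \<in> S" for x
      using c[OF that] calculation[OF that] nz1[OF that] by (auto simp: W_def field_simps)
    ultimately show ?thesis
      using False by blast
  qed
next
  assume ?R
  then show "W constant_on S"
  proof (elim disjE conjE exE)
    assume "f1 constant_on S"
    then obtain c where c: "f1 x = c" if "x \<in> S" for x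
      by (auto simp: constant_on_def)
    have "A x = 0" if "x \<in> S" for x
      using partial_deriv_cong[OF open_S that c] by simp
    then show ?thesis
      by (auto simp: constant_on_def W_def)
  next
    fix c0 assume "\<forall>x\<in>S. A x \<noteq> 0" "\<forall>x\<in>S. f2 x = c0 * ((f1 x)\<^sup>2 / A x)"
    then have "\<forall>x\<in>S. W x = c0"
      using nz1 by (auto simp: W_def)
    then show ?thesis
      by (auto simp: constant_on_def)
  qed
qed

end

theorem proposition2p6:
  fixes I1 I2 I3 :: "real set" and I :: "(real ^ 3) set" and f1 f2 :: "real ^ 3 \<Rightarrow> real"
  assumes "open I1" "is_interval I1"
    and "open I2" "is_interval I2"
    and "open I3" "is_interval I3"
    and "I = box3 I1 I2 I3"
    and "smooth_on I f1" "smooth_on I f2"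
    and "\<forall>x\<in>I. f1 x \<noteq> 0" "\<forall>x\<in>I. f2 x \<noteq> 0"
    and "depends_only_on_x2 I f1" "depends_only_on_x2 I f2"
  shows "(flat_riemannian_manifold I (metric_tilde f1 f2) \<longleftrightarrow>
           (\<forall>x\<in>I. deriv_x2 f1 x / f1 x * (deriv_x2 f2 x / f2 x) + deriv_x2 (deriv_x2 f1) x / f1 x
                    = 2 * (deriv_x2 f1 x / f1 x)\<^sup>2))
       \<and> ((\<forall>x\<in>I. deriv_x2 f1 x / f1 x * (deriv_x2 f2 x / f2 x) + deriv_x2 (deriv_x2 f1) x / f1 x
                    = 2 * (deriv_x2 f1 x / f1 x)\<^sup>2) \<longleftrightarrow>
           f1 constant_on I \<or>
           (\<forall>x\<in>I. deriv_x2 f1 x \<noteq> 0) \<and>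
           (\<exists>c0. c0 \<noteq> 0 \<and> (\<forall>x\<in>I. f2 x = c0 * ((f1 x)\<^sup>2 / deriv_x2 f1 x))))"
proof -
  interpret x2_metric I f1 f2
    using assms open_box3 by unfold_locales auto
  have "convex I"
    using assms convex_box3 by auto
  \<comment> \<open>\<open>K x = 0\<close> is the differential equation with its right side moved to
    the left, and constancy of \<open>W\<close> links it to the explicit solutions.\<close>
  from flat_iff K_zero_iff_W_constant[OF this] W_constant_iff[OF this] show ?thesis
    by (simp add: K_def)
qed

end
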